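(* Let $X=\{x_{1},\ldots,x_{l}\}$ and $Y=\{-y_{1},\ldots,-y_{m}\}$ be disjoint nonempty sets of odd integers, where $x_{1}>\cdots>x_{l}$ are positive odd integers and $y_{1}<\cdots<y_{m}$ are positive odd integers. Let $L=\sum_{i=1}^{l}x_{i}$, $M=\sum_{i=1}^{m}y_{i}$ and $n=lM+mL$. Then there exists a tournament of order $n$ whose imbalance set is $X\cup Y$.
   Context: A tournament is an orientation of a complete simple graph; its order is its number of vertices. The imbalance of a vertex $v$ in a digraph is $d^{+}(v)-d^{-}(v)$ (outdegree minus indegree). The imbalance set of a digraph is the set of imbalances of its vertices. *)

theory Defs
  imports "Graph_Theory.Digraph"
begin

text \<open>
  The locale \<^locale>\<open>digraph\<close> already supplies finiteness and the absence of loops and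
  of parallel arcs. \<open>\<noteq>\<close> on truth values is exclusive or, so exactly one of the two
  possible arcs between distinct vertices is present.
\<close>

locale tournament = digraph +
  assumes orientation:
    "\<And>u v. u \<in> verts G \<Longrightarrow> v \<in> verts G \<Longrightarrow> u \<noteq> v \<Longrightarrow>
      ((u, v) \<in> arcs_ends G) \<noteq> ((v, u) \<in> arcs_ends G)"

definition imbalance :: "('a, 'b) pre_digraph \<Rightarrow> 'a \<Rightarrow> int" where
  "imbalance G v = int (out_degree G v) - int (in_degree G v)"

definition imbalance_set :: "('a, 'b) pre_digraph \<Rightarrow> int set" where
  "imbalance_set G = imbalance G ` verts G"

end

theory Submission
  imports Defs "HOL-Library.Countable"
begin

text \<open>
  For every pair \<open>(i, j)\<close> take a regular tournament on \<open>y\<^sub>j\<close> vertices all of which beat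
  a regular tournament on \<open>x\<^sub>i\<close> vertices; both exist because the orders are odd. In this block
  of order \<open>x\<^sub>i + y\<^sub>j\<close> the vertices have imbalance \<open>x\<^sub>i\<close> and \<open>-y\<^sub>j\<close>, respectively. All blocks
  have even order, so the arcs between two blocks can be chosen such that every vertex beats exactly
  half of the other block, which leaves all imbalances unchanged. The number
  of vertices is \<open>\<Sum>\<^sub>i \<Sum>\<^sub>j (x\<^sub>i + y\<^sub>j) = lM + mL\<close>.
\<close>

text \<open>
  A tournament on \<open>V\<close> is encoded by its skew-symmetric adjacency matrix, the row sums of which are
  the imbalances.
\<close>
definition tournament_matrix :: "'a set \<Rightarrow> ('a \<Rightarrow> 'a \<Rightarrow> int) \<Rightarrow> bool" where
  "tournament_matrix V s \<longleftrightarrow>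
    (\<forall>u\<in>V. \<forall>v\<in>V. s v u = - s u v \<and> (u \<noteq> v \<longrightarrow> \<bar>s u v\<bar> = 1))"

lemma tournament_matrix_neg:
  "tournament_matrix V s \<Longrightarrow> u \<in> V \<Longrightarrow> v \<in> V \<Longrightarrow> s v u = - s u v"
  unfolding tournament_matrix_def by blast

lemma tournament_matrix_abs:
  "tournament_matrix V s \<Longrightarrow> u \<in> V \<Longrightarrow> v \<in> V \<Longrightarrow> u \<noteq> v \<Longrightarrow> \<bar>s u v\<bar> = 1"
  unfolding tournament_matrix_def by blast

lemma sum_signs:
  fixes f :: "'a \<Rightarrow> int"
  assumes "finite V" "\<And>v. v \<in> V \<Longrightarrow> \<bar>f v\<bar> \<le> 1"
  shows "sum f V = int (card {v \<in> V. f v = 1}) - int (card {v \<in> V. f v = -1})"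
proof -
  have "sum f V = (\<Sum>v\<in>V. (if f v = 1 then 1 else 0) - (if f v = -1 then 1 else 0))"
    using assms(2) by (intro sum.cong) (auto, force)
  also have "\<dots> = int (card {v \<in> V. f v = 1}) - int (card {v \<in> V. f v = -1})"
    using assms(1) by (simp add: sum_subtractf flip: sum.inter_filter)
  finally show ?thesis .
qed

text \<open>Let \<open>u\<close> beat \<open>v\<close> when the entry \<open>s u v\<close> is 1. By
  skew-symmetry the diagonal is 0 and the entries -1 in row \<open>u\<close> mark the in-neighbours
  of \<open>u\<close>, so the row sum counts out-arcs minus in-arcs.\<close>

lemma tournament_of_matrix:
  fixes V :: "'a set"
  assumes fin: "finite V" and s: "tournament_matrix V s"
  shows "\<exists>T :: ('a, 'a \<times> 'a) pre_digraph. tournament T \<and> verts T = V \<and>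
    (\<forall>u\<in>V. imbalance T u = (\<Sum>v\<in>V. s u v))"
proof -
  define T :: "('a, 'a \<times> 'a) pre_digraph" where
    "T = \<lparr>verts = V, arcs = {(u, v). u \<in> V \<and> v \<in> V \<and> s u v = 1}, tail = fst, head = snd\<rparr>"
  have diag: "s u u = 0" if "u \<in> V" for u
    using tournament_matrix_neg[OF s that that] by simp
  have ends: "(u, v) \<in> arcs_ends T \<longleftrightarrow> u \<in> V \<and> v \<in> V \<and> s u v = 1" for u v
    by (auto simp: T_def arcs_ends_def arc_to_ends_def)
  have fin_arcs: "finite {(u, v). u \<in> V \<and> v \<in> V \<and> s u v = 1}"
    by (rule finite_subset[of _ "V \<times> V"]) (use fin in auto)
  have "tournament T"
  proof
    fix u v assume "u \<in> verts T" "v \<in> verts T" "u \<noteq> v"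
    then show "((u, v) \<in> arcs_ends T) \<noteq> ((v, u) \<in> arcs_ends T)"
      using tournament_matrix_neg[OF s, of u v] tournament_matrix_abs[OF s, of u v]
      unfolding ends by (auto simp: T_def)
  qed (use fin fin_arcs diag in \<open>auto simp: T_def arc_to_ends_def\<close>)
  moreover have "imbalance T u = (\<Sum>v\<in>V. s u v)" if u: "u \<in> V" for u
  proof -
    have "out_arcs T u = Pair u ` {v \<in> V. s u v = 1}"
      using u by (auto simp: T_def out_arcs_def)
    then have out: "out_degree T u = card {v \<in> V. s u v = 1}"
      by (simp add: out_degree_def card_image inj_on_def)
    have "in_arcs T u = (\<lambda>v. (v, u)) ` {v \<in> V. s u v = -1}"
      using u tournament_matrix_neg[OF s _ u] by (force simp: T_def in_arcs_def)
    then have in': "in_degree T u = card {v \<in> V. s u v = -1}"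
      by (simp add: in_degree_def card_image inj_on_def)
    have "\<bar>s u v\<bar> \<le> 1" if "v \<in> V" for v
      using tournament_matrix_abs[OF s u that] diag[OF u] by (cases "u = v") auto
    then show ?thesis
      using sum_signs[OF fin, of "s u"] by (simp add: imbalance_def out in')
  qed
  ultimately show ?thesis by (auto simp: T_def)
qed

text \<open>Transports a matrix along \<open>to_nat\<close>, so that the construction may use
  structured vertices (block index, position) although the final tournament must live on
  \<open>nat\<close>.\<close>

lemma nat_tournament_of_matrix:
  fixes V :: "'a :: countable set"
  assumes fin: "finite V" and s: "tournament_matrix V s"
  shows "\<exists>T :: (nat, nat \<times> nat) pre_digraph. tournament T \<and> card (verts T) = card V \<and>
    imbalance_set T = (\<lambda>u. \<Sum>v\<in>V. s u v) ` V"
proof -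
  define s' where "s' = (\<lambda>u v. s (from_nat u) (from_nat v))"
  have "tournament_matrix (to_nat ` V) s'"
  proof -
    have "tournament_matrix (to_nat ` V) s' \<longleftrightarrow> tournament_matrix V s"
      by (simp add: tournament_matrix_def s'_def)
    with s show ?thesis by simp
  qed
  from tournament_of_matrix[OF finite_imageI[OF fin] this]
  obtain T :: "(nat, nat \<times> nat) pre_digraph" where T: "tournament T" "verts T = to_nat ` V"
    "\<forall>u\<in>to_nat ` V. imbalance T u = (\<Sum>v\<in>to_nat ` V. s' u v)"
    by (elim exE conjE)
  have "imbalance T (to_nat u) = (\<Sum>v\<in>V. s u v)" if "u \<in> V" for u
    using that by (simp add: T(3) sum.reindex s'_def)
  then have "imbalance_set T = (\<lambda>u. \<Sum>v\<in>V. s u v) ` V"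
    by (simp add: imbalance_set_def T(2) image_image)
  then show ?thesis
    using T by (auto simp: card_image)
qed

text \<open>For odd \<open>a\<close>, the restriction to \<open>{..<a}\<close> is the circulant
  tournament in which \<open>k\<close> beats \<open>k + 2, k + 4, ..., k + (a - 1)\<close> modulo
  \<open>a\<close>. This form avoids modular arithmetic and does not mention
  \<open>a\<close>.\<close>

definition alternating :: "nat \<Rightarrow> nat \<Rightarrow> int" where
  "alternating k k' = sgn (int k' - int k) * (-1) ^ (k + k')"

lemma alternating_neg: "alternating k' k = - alternating k k'"
  by (simp add: alternating_def sgn_if add.commute)

lemma abs_alternating: "k \<noteq> k' \<Longrightarrow> \<bar>alternating k k'\<bar> = 1"
  by (simp add: alternating_def abs_mult sgn_if power_abs)

text \<open>Lets the same matrix describe the second regular tournament of a block, whose positions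
  start at \<open>a\<close>.\<close>

lemma alternating_shift: "alternating (a + k) (a + k') = alternating k k'"
proof -
  have "a + k + (a + k') = 2 * a + (k + k')" by simp
  then show ?thesis by (simp add: alternating_def power_add power_mult)
qed

text \<open>The nonzero entries of row \<open>k\<close> alternate in sign, even across the zero at
  position \<open>k\<close>, and the first of them is \<open>- ((-1) ^ k)\<close>. Hence a partial
  sum depends only on the parity of the number of nonzero entries, which is \<open>a\<close> if
  \<open>a \<le> k\<close> and \<open>a - 1\<close> otherwise.\<close>

lemma sum_alternating:
  "(\<Sum>k'<a. alternating k k') = (if odd a \<longleftrightarrow> a \<le> k then - ((-1) ^ k) else 0)"
proof (induction a)
  case (Suc a)
  have "alternating k a =
      (if a = k then 0 else if even a \<longleftrightarrow> a < k then - ((-1) ^ k) else (-1) ^ k)"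
    by (auto simp: alternating_def power_add)
  moreover have "a \<le> k \<longleftrightarrow> a < k \<or> a = k" by auto
  ultimately show ?case
    using Suc by (auto simp: Suc_le_eq)
qed simp

lemma sum_alternating_odd: "odd a \<Longrightarrow> k < a \<Longrightarrow> (\<Sum>k'<a. alternating k k') = 0"
  by (simp add: sum_alternating)

lemma sum_alternating_sign_even: "even a \<Longrightarrow> (\<Sum>k<a. (-1 :: int) ^ k) = 0"
  by (induction a rule: induct_nat_012) auto

text \<open>The regular tournament on \<open>{..<a}\<close> beats the one on \<open>{a..<a + b}\<close>.\<close>
definition block :: "nat \<Rightarrow> nat \<Rightarrow> nat \<Rightarrow> int" where
  "block a k k' = (if (k < a) = (k' < a) then alternating k k' else if k < a then 1 else -1)"

lemma tournament_matrix_block: "tournament_matrix V (block a)"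
proof -
  have "block a v u = - block a u v \<and> (u \<noteq> v \<longrightarrow> \<bar>block a u v\<bar> = 1)" for u v
    using alternating_neg[of u v] by (auto simp: block_def abs_alternating)
  then show ?thesis unfolding tournament_matrix_def by blast
qed

lemma sum_lessThan_add:
  fixes f :: "nat \<Rightarrow> 'a :: comm_monoid_add"
  shows "(\<Sum>k<a + b. f k) = (\<Sum>k<a. f k) + (\<Sum>k<b. f (a + k))"
  by (induction b) (simp_all add: add.assoc)

text \<open>The part containing \<open>k\<close> is regular and contributes 0; the opposite part
  contributes its size, with a sign telling which part wins.\<close>

lemma sum_block:
  assumes "odd a" "odd b" "k < a + b"
  shows "(\<Sum>k'<a + b. block a k k') = (if k < a then int b else - int a)"
proof (cases "k < a")
  case True
  then show ?thesis
    using assms by (simp add: sum_lessThan_add block_def sum_alternating_odd)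
next
  case False
  then obtain j where j: "k = a + j" by (metis le_add_diff_inverse linorder_not_le)
  have "(\<Sum>k'<b. block a k (a + k')) = 0"
    using assms by (simp add: j block_def alternating_shift sum_alternating_odd)
  then show ?thesis
    by (simp add: j sum_lessThan_add block_def)
qed

text \<open>Between two blocks a vertex of the earlier one beats exactly the positions of its own
  parity in the later one. \<open>to_nat\<close> only serves to order the block indices, which makes
  the matrix skew-symmetric.\<close>

definition join_blocks ::
    "('p :: countable \<Rightarrow> nat \<Rightarrow> nat \<Rightarrow> int) \<Rightarrow> 'p \<times> nat \<Rightarrow> 'p \<times> nat \<Rightarrow> int" where
  "join_blocks c u v = (if fst u = fst v then c (fst u) (snd u) (snd v)
     else sgn (int (to_nat (fst v)) - int (to_nat (fst u))) * (-1) ^ (snd u + snd v))"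

lemma tournament_matrix_join_blocks:
  assumes "\<And>p. p \<in> P \<Longrightarrow> tournament_matrix {..<N p} (c p)"
  shows "tournament_matrix (Sigma P (\<lambda>p. {..<N p})) (join_blocks c)"
proof -
  have "join_blocks c v u = - join_blocks c u v \<and> (u \<noteq> v \<longrightarrow> \<bar>join_blocks c u v\<bar> = 1)"
    if "u \<in> Sigma P (\<lambda>p. {..<N p})" "v \<in> Sigma P (\<lambda>p. {..<N p})" for u v
  proof (cases "fst u = fst v")
    case True
    with that have "tournament_matrix {..<N (fst u)} (c (fst u))"
      "snd u \<in> {..<N (fst u)}" "snd v \<in> {..<N (fst u)}"
      using assms by auto
    then show ?thesis
      using True tournament_matrix_neg[of _ "c (fst u)" "snd u" "snd v"]
        tournament_matrix_abs[of _ "c (fst u)" "snd u" "snd v"]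
      by (simp add: join_blocks_def prod_eq_iff)
  next
    case False
    then have "to_nat (fst u) \<noteq> to_nat (fst v)" by simp
    with False show ?thesis
      by (auto simp: join_blocks_def sgn_if abs_mult power_abs add.commute)
  qed
  then show ?thesis unfolding tournament_matrix_def by blast
qed

text \<open>In every other block the row is, up to sign, an alternating sequence of even length, so
  only the block of \<open>p\<close> itself contributes.\<close>

lemma sum_join_blocks:
  assumes "finite P" "\<And>q. q \<in> P \<Longrightarrow> even (N q)" "p \<in> P"
  shows "(\<Sum>v\<in>Sigma P (\<lambda>p. {..<N p}). join_blocks c (p, k) v) = (\<Sum>k'<N p. c p k k')"
proof -
  have other: "(\<Sum>k'<N q. join_blocks c (p, k) (q, k')) = 0" if "q \<in> P - {p}" for q
  proof -
    have "(\<Sum>k'<N q. join_blocks c (p, k) (q, k')) =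
        sgn (int (to_nat q) - int (to_nat p)) * (-1) ^ k * (\<Sum>k'<N q. (-1) ^ k')"
      using that by (auto simp: join_blocks_def sum_distrib_left power_add mult.assoc)
    then show ?thesis
      using that assms(2) by (simp add: sum_alternating_sign_even)
  qed
  have "(\<Sum>v\<in>Sigma P (\<lambda>p. {..<N p}). join_blocks c (p, k) v) =
      (\<Sum>q\<in>P. \<Sum>k'<N q. join_blocks c (p, k) (q, k'))"
    using assms(1) by (simp add: sum.Sigma)
  also have "\<dots> = (\<Sum>k'<N p. join_blocks c (p, k) (p, k'))"
    using assms other by (simp add: sum.remove)
  finally show ?thesis by (simp add: join_blocks_def)
qed

theorem theorem2p3:
  fixes l m :: nat and x y :: "nat \<Rightarrow> int" and X Y :: "int set" and L M n :: int
  assumes X: "X = x ` {1..l}" and Y: "Y = (\<lambda>i. - y i) ` {1..m}"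
    and disjoint: "X \<inter> Y = {}" and nonempty: "X \<noteq> {}" "Y \<noteq> {}"
    and x_decreasing: "strict_antimono_on {1..l} x"
    and x_pos_odd: "\<And>i. i \<in> {1..l} \<Longrightarrow> 0 < x i \<and> odd (x i)"
    and y_increasing: "strict_mono_on {1..m} y"
    and y_pos_odd: "\<And>i. i \<in> {1..m} \<Longrightarrow> 0 < y i \<and> odd (y i)"
    and L: "L = (\<Sum>i=1..l. x i)" and M: "M = (\<Sum>i=1..m. y i)"
    and n: "n = int l * M + int m * L"
  shows "\<exists>T :: (nat, nat \<times> nat) pre_digraph.
    tournament T \<and> int (card (verts T)) = n \<and> imbalance_set T = X \<union> Y"
proof -
  define P where "P = {1..l} \<times> {1..m}"
  \<comment> \<open>The winning part gets its size from \<open>y\<close> and the losing part from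
    \<open>x\<close>, because the imbalance of a vertex is, up to sign, the size of the opposite
    part.\<close>
  define b a where "b p = nat (x (fst p))" and "a p = nat (y (snd p))" for p :: "nat \<times> nat"
  define V where "V = Sigma P (\<lambda>p. {..<a p + b p})"
  define s where "s = join_blocks (\<lambda>p. block (a p))"
  have b: "odd (b p)" "int (b p) = x (fst p)" "0 < b p"
    and a: "odd (a p)" "int (a p) = y (snd p)" "0 < a p" if "p \<in> P" for p
    using that x_pos_odd[of "fst p"] y_pos_odd[of "snd p"]
    by (auto simp: P_def a_def b_def even_nat_iff)
  have fin: "finite P" by (simp add: P_def)
  \<comment> \<open>Oddness of \<open>a p\<close> and \<open>b p\<close> enters twice: each part is
    regular, and the block order \<open>a p + b p\<close> is even.\<close>
  have row: "(\<Sum>v\<in>V. s (p, k) v) = (if k < a p then x (fst p) else - y (snd p))"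
    if "p \<in> P" "k < a p + b p" for p k
    using that a b fin by (simp add: V_def s_def sum_join_blocks sum_block)
  have in_V: "(p, k) \<in> V \<longleftrightarrow> p \<in> P \<and> k < a p + b p" for p k
    by (simp add: V_def)
  have "tournament_matrix V s"
    unfolding V_def s_def by (intro tournament_matrix_join_blocks tournament_matrix_block)
  moreover have "finite V" by (simp add: V_def fin)
  ultimately have "\<exists>T :: (nat, nat \<times> nat) pre_digraph. tournament T \<and> card (verts T) = card V \<and>
      imbalance_set T = (\<lambda>u. \<Sum>v\<in>V. s u v) ` V"
    by (rule nat_tournament_of_matrix[rotated])
  then obtain T :: "(nat, nat \<times> nat) pre_digraph" where
    T: "tournament T" "card (verts T) = card V" "imbalance_set T = (\<lambda>u. \<Sum>v\<in>V. s u v) ` V"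
    by (elim exE conjE)
  have "int (card V) = (\<Sum>p\<in>P. x (fst p) + y (snd p))"
    using a b fin by (simp add: V_def add.commute)
  also have "\<dots> = (\<Sum>i=1..l. \<Sum>j=1..m. x i + y j)"
    by (simp add: P_def sum.cartesian_product case_prod_beta)
  also have "\<dots> = n"
    by (simp add: n L M sum.distrib sum_distrib_left)
  finally have card: "int (card V) = n" .
  have "X \<union> Y \<subseteq> (\<lambda>u. \<Sum>v\<in>V. s u v) ` V"
  proof
    fix z assume z: "z \<in> X \<union> Y"
    \<comment> \<open>A value from one set occurs only in a block shared with a value from the other
      set; these indices supply the partner.\<close>
    obtain i0 j0 where "i0 \<in> {1..l}" "j0 \<in> {1..m}"
      using nonempty X Y by blast
    with z consider i where "(i, j0) \<in> P" "z = x i" | j where "(i0, j) \<in> P" "z = - y j"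
      unfolding X Y P_def by blast
    then show "z \<in> (\<lambda>u. \<Sum>v\<in>V. s u v) ` V"
    proof cases
      case 1
      then show ?thesis
        \<comment> \<open>Position 0 lies in the winning part, which is nonempty.\<close>
        using a(3)[of "(i, j0)"] by (intro image_eqI[of _ _ "((i, j0), 0)"]) (auto simp: row in_V)
    next
      case 2
      then show ?thesis
        \<comment> \<open>Position \<open>a (i0, j)\<close> is the first one of the losing part, and
          it exists because \<open>b (i0, j)\<close> is positive.\<close>
        using b(3)[of "(i0, j)"]
        by (intro image_eqI[of _ _ "((i0, j), a (i0, j))"]) (auto simp: row in_V)
    qed
  qed
  moreover have "(\<lambda>u. \<Sum>v\<in>V. s u v) ` V \<subseteq> X \<union> Y"
  proof
    fix z assume "z \<in> (\<lambda>u. \<Sum>v\<in>V. s u v) ` V"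
    then obtain p k where "p \<in> P" "z = (if k < a p then x (fst p) else - y (snd p))"
      using row by (auto simp: in_V)
    then show "z \<in> X \<union> Y"
      by (auto simp: X Y P_def)
  qed
  ultimately have "imbalance_set T = X \<union> Y"
    unfolding T(3) by (rule equalityI[rotated])
  with T card show ?thesis by (intro exI[of _ T]) simp
qed

end
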